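(* Let $X=(M,J)$ be an almost complex manifold of real dimension $2n$ with a global frame $\{v_1,w_1,\dots,v_n,w_n\}$ of $TM$ such that $Jv_i=w_i$, $Jw_i=-v_i$ for all $i$. Let $\mathcal{X}_k=\frac12(v_k-\sqrt{-1}\,w_k)$, let $\varphi^i=v^i+\sqrt{-1}\,w^i$ (with $\{v^i,w^i\}$ the dual coframe), let the smooth functions $\lambda^i_{jk}$ be defined by $\bar\partial\varphi^i=\sum_{j,k}\lambda^i_{jk}\varphi^j\wedge\bar\varphi^k$, and put $\alpha_k=\sum_{i}\lambda^i_{ik}$. Let $m\ge1$ be an integer and let $u,v:M\to\mathbb{R}$ be smooth functions such that for every $k=1,\dots,n$ $$v_k(u)-w_k(v)=2m\big(\mathrm{Re}(\alpha_k)u-\mathrm{Im}(\alpha_k)v\big),\qquad v_k(v)+w_k(u)=2m\big(\mathrm{Re}(\alpha_k)v+\mathrm{Im}(\alpha_k)u\big).$$ Set $$\beta=\sum_{k=1}^n\Big(\mathcal{X}_k(\alpha_k)+\sum_{i=1}^n\lambda^i_{kk}\bar\alpha_i\Big),\qquad R_m=\mathrm{Re}\sum_{k=1}^n\Big(\mathcal{X}_k(\alpha_k)-m|\alpha_k|^2-\sum_{i=1}^n\lambda^i_{kk}\bar\alpha_i\Big),$$ and let $L_m$ be the second order elliptic operator $$L_m(h)=\sum_{k=1}^n\Big(v_k(v_k(h))+w_k(w_k(h))-4m\,\mathrm{Re}(\alpha_k)v_k(h)-4m\,\mathrm{Im}(\alpha_k)w_k(h)-2\sum_{i=1}^n\mathrm{Re}(\lambda^i_{kk})v_i(h)-2\sum_{i=1}^n\mathrm{Im}(\lambda^i_{kk})w_i(h)\Big).$$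 Then $$L_m(v)-4mR_m\,v-4m\,\mathrm{Im}(\beta)\,u=0,\qquad -L_m(u)+4mR_m\,u-4m\,\mathrm{Im}(\beta)\,v=0.$$
   Context: $J$ is a smooth endomorphism of $TM$ with $J^2=-\mathrm{id}$, not necessarily integrable. $\bar\partial$ is the component of $d$ mapping $(p,q)$-forms to $(p,q+1)$-forms. For a vector field $\xi$ and a function $h$, $\xi(h)$ is the derivative of $h$ along $\xi$ (complex vector fields act by complex linearity). Note that $v$ without index denotes a function, while $v_k$ denotes a vector field of the frame. *)

theory Defs
  imports "HOL-Analysis.Analysis"
begin

section \<open>Smooth manifolds\<close>

primrec Ck_on :: "nat \<Rightarrow> 'e::euclidean_space set \<Rightarrow> ('e \<Rightarrow> 'b::real_normed_vector) \<Rightarrow> bool" where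
  "Ck_on 0 S f \<longleftrightarrow> continuous_on S f"
| "Ck_on (Suc k) S f \<longleftrightarrow> (\<forall>x\<in>S. f differentiable (at x)) \<and>
     (\<forall>a. Ck_on k S (\<lambda>x. frechet_derivative f (at x) a))"

definition smooth_on :: "'e::euclidean_space set \<Rightarrow> ('e \<Rightarrow> 'b::real_normed_vector) \<Rightarrow> bool" where
  "smooth_on S f \<longleftrightarrow> (\<forall>k. Ck_on k S f)"

text \<open>A chart is a pair of its domain and its coordinate map; only the values of the
  coordinate map on the domain matter. The manifold is the whole type \<^typ>\<open>'a\<close>.\<close>

type_synonym ('a, 'e) chart = "'a set \<times> ('a \<Rightarrow> 'e)"

definition is_chart :: "('a::topological_space, 'e::euclidean_space) chart \<Rightarrow> bool" where
  "is_chart c \<longleftrightarrow> (case c of (U, \<kappa>) \<Rightarrow>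
     open U \<and> open (\<kappa> ` U) \<and> homeomorphism U (\<kappa> ` U) \<kappa> (inv_into U \<kappa>))"

definition smooth_atlas ::
  "('a::{t2_space, second_countable_topology}, 'e::euclidean_space) chart set \<Rightarrow> bool" where
  "smooth_atlas A \<longleftrightarrow>
     (\<forall>c\<in>A. is_chart c) \<and> (\<Union>(U, \<kappa>)\<in>A. U) = UNIV \<and>
     (\<forall>(U, \<kappa>)\<in>A. \<forall>(U', \<kappa>')\<in>A. smooth_on (\<kappa> ` (U \<inter> U')) (\<lambda>x. \<kappa>' (inv_into U \<kappa> x)))"

definition smooth_fun ::
  "('a, 'e::euclidean_space) chart set \<Rightarrow> ('a \<Rightarrow> 'b::real_normed_vector) \<Rightarrow> bool" where
  "smooth_fun A f \<longleftrightarrow> (\<forall>(U, \<kappa>)\<in>A. smooth_on (\<kappa> ` U) (\<lambda>x. f (inv_into U \<kappa> x)))"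


section \<open>Tangent vectors, vector fields and forms\<close>

text \<open>Tangent vectors at a point are derivations at that point of the algebra of smooth real
  functions. The last clause fixes the irrelevant values on non-smooth functions, so that
  equality of tangent vectors is equality in HOL.\<close>

type_synonym 'a tvec = "('a \<Rightarrow> real) \<Rightarrow> real"
type_synonym 'a vfield = "'a \<Rightarrow> 'a tvec"

definition tangent_space :: "('a, 'e::euclidean_space) chart set \<Rightarrow> 'a \<Rightarrow> 'a tvec set" where
  "tangent_space A p = {D.
     (\<forall>f g. smooth_fun A f \<longrightarrow> smooth_fun A g \<longrightarrow> D (\<lambda>q. f q + g q) = D f + D g) \<and>
     (\<forall>c f. smooth_fun A f \<longrightarrow> D (\<lambda>q. c * f q) = c * D f) \<and>
     (\<forall>f g. smooth_fun A f \<longrightarrow> smooth_fun A g \<longrightarrow> D (\<lambda>q. f q * g q) = f p * D g + g p * D f) \<and>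
     (\<forall>f. \<not> smooth_fun A f \<longrightarrow> D f = 0)}"

definition deriv_along :: "'a vfield \<Rightarrow> ('a \<Rightarrow> real) \<Rightarrow> 'a \<Rightarrow> real" where
  "deriv_along X h = (\<lambda>p. X p h)"

definition cderiv_along :: "'a vfield \<Rightarrow> ('a \<Rightarrow> complex) \<Rightarrow> 'a \<Rightarrow> complex" where
  "cderiv_along X h = (\<lambda>p. Complex (deriv_along X (\<lambda>q. Re (h q)) p) (deriv_along X (\<lambda>q. Im (h q)) p))"

definition smooth_vfield :: "('a, 'e::euclidean_space) chart set \<Rightarrow> 'a vfield \<Rightarrow> bool" where
  "smooth_vfield A X \<longleftrightarrow> (\<forall>p. X p \<in> tangent_space A p) \<and>
     (\<forall>f. smooth_fun A f \<longrightarrow> smooth_fun A (deriv_along X f))"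

definition lie_bracket :: "'a vfield \<Rightarrow> 'a vfield \<Rightarrow> 'a vfield" where
  "lie_bracket X Y = (\<lambda>p f. deriv_along X (deriv_along Y f) p - deriv_along Y (deriv_along X f) p)"

text \<open>A 1-form is a smooth field of linear functionals on the tangent spaces, a 2-form is
  evaluated on pairs of vector fields. Complex forms are complex-valued real-multilinear forms.\<close>

type_synonym ('a, 'r) form1 = "'a \<Rightarrow> 'a tvec \<Rightarrow> 'r"
type_synonym 'a cform2 = "'a vfield \<Rightarrow> 'a vfield \<Rightarrow> 'a \<Rightarrow> complex"

definition smooth_form1 ::
  "('a, 'e::euclidean_space) chart set \<Rightarrow> ('a, 'r::real_normed_vector) form1 \<Rightarrow> bool" where
  "smooth_form1 A \<theta> \<longleftrightarrow>
     (\<forall>p. \<forall>a\<in>tangent_space A p. \<forall>b\<in>tangent_space A p. \<theta> p (\<lambda>f. a f + b f) = \<theta> p a + \<theta> p b) \<and>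
     (\<forall>p. \<forall>a\<in>tangent_space A p. \<forall>c. \<theta> p (\<lambda>f. c * a f) = c *\<^sub>R \<theta> p a) \<and>
     (\<forall>X. smooth_vfield A X \<longrightarrow> smooth_fun A (\<lambda>p. \<theta> p (X p)))"

definition wedge :: "('a, complex) form1 \<Rightarrow> ('a, complex) form1 \<Rightarrow> 'a cform2" where
  "wedge \<theta> \<eta> X Y p = \<theta> p (X p) * \<eta> p (Y p) - \<theta> p (Y p) * \<eta> p (X p)"

text \<open>The invariant formula for the exterior derivative, in the normalisation matching
  \<^const>\<open>wedge\<close> (no factor 1/2).\<close>

definition ext_deriv :: "('a, complex) form1 \<Rightarrow> 'a cform2" where
  "ext_deriv \<theta> X Y p =
     cderiv_along X (\<lambda>q. \<theta> q (Y q)) p - cderiv_along Y (\<lambda>q. \<theta> q (X q)) p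
     - \<theta> p (lie_bracket X Y p)"


section \<open>Almost complex structures\<close>

definition almost_complex ::
  "('a, 'e::euclidean_space) chart set \<Rightarrow> ('a \<Rightarrow> 'a tvec \<Rightarrow> 'a tvec) \<Rightarrow> bool" where
  "almost_complex A J \<longleftrightarrow>
     (\<forall>p. \<forall>a\<in>tangent_space A p. J p a \<in> tangent_space A p) \<and>
     (\<forall>p. \<forall>a\<in>tangent_space A p. \<forall>b\<in>tangent_space A p.
        J p (\<lambda>f. a f + b f) = (\<lambda>f. J p a f + J p b f)) \<and>
     (\<forall>p. \<forall>a\<in>tangent_space A p. \<forall>c. J p (\<lambda>f. c * a f) = (\<lambda>f. c * J p a f)) \<and>
     (\<forall>X. smooth_vfield A X \<longrightarrow> smooth_vfield A (\<lambda>p. J p (X p))) \<and>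
     (\<forall>p. \<forall>a\<in>tangent_space A p. J p (J p a) = (\<lambda>f. - a f))"

text \<open>A complex vector field is a pair \<open>(X, Y)\<close> of real ones, standing for \<open>X + \<i>Y\<close>.\<close>

type_synonym 'a cvfield = "'a vfield \<times> 'a vfield"

definition cvf_apply :: "'a cvfield \<Rightarrow> ('a \<Rightarrow> complex) \<Rightarrow> 'a \<Rightarrow> complex" where
  "cvf_apply Z h p = cderiv_along (fst Z) h p + \<i> * cderiv_along (snd Z) h p"

definition cform2_eval :: "'a cform2 \<Rightarrow> 'a cvfield \<Rightarrow> 'a cvfield \<Rightarrow> 'a \<Rightarrow> complex" where
  "cform2_eval \<omega> Z Z' p =
     \<omega> (fst Z) (fst Z') p - \<omega> (snd Z) (snd Z') p
     + \<i> * (\<omega> (fst Z) (snd Z') p + \<omega> (snd Z) (fst Z') p)"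

text \<open>The components \<open>(X - \<i>JX)/2\<close> and \<open>(X + \<i>JX)/2\<close> of a real vector field \<open>X\<close>.\<close>

definition part10 :: "('a \<Rightarrow> 'a tvec \<Rightarrow> 'a tvec) \<Rightarrow> 'a vfield \<Rightarrow> 'a cvfield" where
  "part10 J X = ((\<lambda>p f. X p f / 2), (\<lambda>p f. - J p (X p) f / 2))"

definition part01 :: "('a \<Rightarrow> 'a tvec \<Rightarrow> 'a tvec) \<Rightarrow> 'a vfield \<Rightarrow> 'a cvfield" where
  "part01 J X = ((\<lambda>p f. X p f / 2), (\<lambda>p f. J p (X p) f / 2))"

definition component11 :: "('a \<Rightarrow> 'a tvec \<Rightarrow> 'a tvec) \<Rightarrow> 'a cform2 \<Rightarrow> 'a cform2" where
  "component11 J \<omega> X Y p =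
     cform2_eval \<omega> (part10 J X) (part01 J Y) p + cform2_eval \<omega> (part01 J X) (part10 J Y) p"

text \<open>The operator \<open>\<partial>\<close>-bar on \<open>(1,0)\<close>-forms, with values in \<open>(1,1)\<close>-forms.\<close>

definition dbar10 :: "('a \<Rightarrow> 'a tvec \<Rightarrow> 'a tvec) \<Rightarrow> ('a, complex) form1 \<Rightarrow> 'a cform2" where
  "dbar10 J \<theta> = component11 J (ext_deriv \<theta>)"


section \<open>Frames\<close>

text \<open>Frames of the tangent bundle and their dual coframes, in the form
  \<open>V 1, W 1, \<dots>, V n, W n\<close>.\<close>

definition global_frame ::
  "('a, 'e::euclidean_space) chart set \<Rightarrow> nat \<Rightarrow> (nat \<Rightarrow> 'a vfield) \<Rightarrow> (nat \<Rightarrow> 'a vfield) \<Rightarrow> bool" where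
  "global_frame A n V W \<longleftrightarrow>
     (\<forall>i\<in>{1..n}. smooth_vfield A (V i) \<and> smooth_vfield A (W i)) \<and>
     (\<forall>p. \<forall>c d. (\<forall>f. (\<Sum>i=1..n. c i * V i p f + d i * W i p f) = 0) \<longrightarrow>
        (\<forall>i\<in>{1..n}. c i = 0 \<and> d i = 0)) \<and>
     (\<forall>p. \<forall>a\<in>tangent_space A p. \<exists>c d.
        a = (\<lambda>f. \<Sum>i=1..n. c i * V i p f + d i * W i p f))"

definition dual_coframe ::
  "('a, 'e::euclidean_space) chart set \<Rightarrow> nat \<Rightarrow> (nat \<Rightarrow> 'a vfield) \<Rightarrow> (nat \<Rightarrow> 'a vfield) \<Rightarrow>
   (nat \<Rightarrow> ('a, real) form1) \<Rightarrow> (nat \<Rightarrow> ('a, real) form1) \<Rightarrow> bool" where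
  "dual_coframe A n V W V' W' \<longleftrightarrow>
     (\<forall>i\<in>{1..n}. smooth_form1 A (V' i) \<and> smooth_form1 A (W' i)) \<and>
     (\<forall>i\<in>{1..n}. \<forall>j\<in>{1..n}. \<forall>p.
        V' i p (V j p) = (if i = j then 1 else 0) \<and> V' i p (W j p) = 0 \<and>
        W' i p (V j p) = 0 \<and> W' i p (W j p) = (if i = j then 1 else 0))"

definition frame10 :: "(nat \<Rightarrow> 'a vfield) \<Rightarrow> (nat \<Rightarrow> 'a vfield) \<Rightarrow> nat \<Rightarrow> 'a cvfield" where
  "frame10 V W k = ((\<lambda>p f. V k p f / 2), (\<lambda>p f. - W k p f / 2))"

definition coframe10 ::
  "(nat \<Rightarrow> ('a, real) form1) \<Rightarrow> (nat \<Rightarrow> ('a, real) form1) \<Rightarrow> nat \<Rightarrow> ('a, complex) form1" where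
  "coframe10 V' W' i p a = complex_of_real (V' i p a) + \<i> * complex_of_real (W' i p a)"

definition cnj_form1 :: "('a, complex) form1 \<Rightarrow> ('a, complex) form1" where
  "cnj_form1 \<theta> p a = cnj (\<theta> p a)"


section \<open>The coefficients and the operator\<close>

text \<open>Throughout, \<open>l i j k\<close> is the coefficient \<open>\<lambda>\<close> with upper index \<open>i\<close> and lower indices \<open>j\<close>, \<open>k\<close>.\<close>

definition alpha :: "nat \<Rightarrow> (nat \<Rightarrow> nat \<Rightarrow> nat \<Rightarrow> 'a \<Rightarrow> complex) \<Rightarrow> nat \<Rightarrow> 'a \<Rightarrow> complex" where
  "alpha n l k p = (\<Sum>i=1..n. l i i k p)"

definition beta ::
  "nat \<Rightarrow> (nat \<Rightarrow> 'a vfield) \<Rightarrow> (nat \<Rightarrow> 'a vfield) \<Rightarrow> (nat \<Rightarrow> nat \<Rightarrow> nat \<Rightarrow> 'a \<Rightarrow> complex) \<Rightarrow>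
   'a \<Rightarrow> complex" where
  "beta n V W l p = (\<Sum>k=1..n.
     cvf_apply (frame10 V W k) (alpha n l k) p + (\<Sum>i=1..n. l i k k p * cnj (alpha n l i p)))"

definition R_fun ::
  "nat \<Rightarrow> (nat \<Rightarrow> 'a vfield) \<Rightarrow> (nat \<Rightarrow> 'a vfield) \<Rightarrow> (nat \<Rightarrow> nat \<Rightarrow> nat \<Rightarrow> 'a \<Rightarrow> complex) \<Rightarrow>
   nat \<Rightarrow> 'a \<Rightarrow> real" where
  "R_fun n V W l m p = Re (\<Sum>k=1..n.
     cvf_apply (frame10 V W k) (alpha n l k) p - of_nat m * of_real ((cmod (alpha n l k p))\<^sup>2)
     - (\<Sum>i=1..n. l i k k p * cnj (alpha n l i p)))"

definition L_op ::
  "nat \<Rightarrow> (nat \<Rightarrow> 'a vfield) \<Rightarrow> (nat \<Rightarrow> 'a vfield) \<Rightarrow> (nat \<Rightarrow> nat \<Rightarrow> nat \<Rightarrow> 'a \<Rightarrow> complex) \<Rightarrow>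
   nat \<Rightarrow> ('a \<Rightarrow> real) \<Rightarrow> 'a \<Rightarrow> real" where
  "L_op n V W l m h p = (\<Sum>k=1..n.
     deriv_along (V k) (deriv_along (V k) h) p + deriv_along (W k) (deriv_along (W k) h) p
     - 4 * real m * Re (alpha n l k p) * deriv_along (V k) h p
     - 4 * real m * Im (alpha n l k p) * deriv_along (W k) h p
     - 2 * (\<Sum>i=1..n. Re (l i k k p) * deriv_along (V i) h p)
     - 2 * (\<Sum>i=1..n. Im (l i k k p) * deriv_along (W i) h p))"

end

theory Submission
  imports Defs
begin

text \<open>Put \<open>F = u + \<i>v\<close> and write \<open>X\<close> for the frame field \<open>(v - \<i>w)/2\<close>. The two real equations
  say that the conjugate of \<open>X\<^sub>k\<close> maps \<open>F\<close> to \<open>m\<alpha>\<^sub>kF\<close>. Evaluating the definition of the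
  \<open>\<lambda>\<close> on the pair \<open>(v\<^sub>k, w\<^sub>k)\<close> expresses the bracket \<open>[v\<^sub>k, w\<^sub>k]\<close> in the frame through
  \<open>\<lambda>\<^sup>i\<^sub>k\<^sub>k\<close>. Since \<open>v\<^sub>kv\<^sub>k + w\<^sub>kw\<^sub>k = (v\<^sub>k - \<i>w\<^sub>k)(v\<^sub>k + \<i>w\<^sub>k) - \<i>[v\<^sub>k, w\<^sub>k]\<close>, differentiating the first
  order equations once more leaves no derivative of \<open>F\<close>: \<open>L\<^sub>m F = 4m(R\<^sub>m + \<i> Im \<beta>) F\<close>. The
  two claims are its imaginary and real parts, which are exchanged by \<open>(u, v) \<mapsto> (v, -u)\<close>.\<close>

section \<open>Smooth functions\<close>

lemma has_derivative_cong_open: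
  assumes "open S" "x \<in> S" "\<And>y. y \<in> S \<Longrightarrow> f y = g y"
  shows "(f has_derivative D) (at x) \<longleftrightarrow> (g has_derivative D) (at x)"
  using assms has_derivative_transform_within_open[of f D x UNIV S g]
    has_derivative_transform_within_open[of g D x UNIV S f] by auto

text \<open>\<open>frechet_derivative\<close> is a Hilbert choice from the derivatives at
  \<open>x\<close>, and these coincide for \<open>f\<close> and \<open>g\<close>; so the equality
  also covers points where neither is differentiable.\<close>

lemma frechet_derivative_cong_open:
  assumes "open S" "x \<in> S" "\<And>y. y \<in> S \<Longrightarrow> f y = g y"
  shows "frechet_derivative f (at x) = frechet_derivative g (at x)"
  unfolding frechet_derivative_def using has_derivative_cong_open[OF assms] by simp

text \<open>The closure lemmas below know a formula for the derivative of a sum, product or linear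
  image only at points of \<open>S\<close>. This congruence lets them pass to that formula inside
  \<open>Ck_on\<close>.\<close>

lemma Ck_on_cong:
  assumes "open S" "\<And>x. x \<in> S \<Longrightarrow> f x = g x"
  shows "Ck_on k S f \<longleftrightarrow> Ck_on k S g"
  using assms(2)
proof (induction k arbitrary: f g)
  case 0
  then show ?case by (simp cong: continuous_on_cong)
next
  case (Suc k)
  have "Ck_on k S (\<lambda>x. frechet_derivative f (at x) a) \<longleftrightarrow>
        Ck_on k S (\<lambda>x. frechet_derivative g (at x) a)" for a
    by (rule Suc.IH) (simp add: frechet_derivative_cong_open[OF assms(1) _ Suc.prems])
  moreover have "f differentiable (at x) \<longleftrightarrow> g differentiable (at x)" if "x \<in> S" for x
    unfolding differentiable_def using has_derivative_cong_open[OF assms(1) that Suc.prems] by simp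
  ultimately show ?case by simp
qed

lemma Ck_on_SucD: "Ck_on (Suc k) S f \<Longrightarrow> Ck_on k S f"
proof (induction k arbitrary: f)
  case 0
  then show ?case
    by (auto intro!: continuous_at_imp_continuous_on differentiable_imp_continuous_within)
next
  case (Suc k)
  then show ?case by (metis Ck_on.simps(2))
qed

lemma Ck_on_const: "Ck_on k S (\<lambda>x. c)"
  by (induction k arbitrary: c) auto

lemma Ck_on_bounded_linear:
  assumes "bounded_linear T" "open S"
  shows "Ck_on k S f \<Longrightarrow> Ck_on k S (\<lambda>x. T (f x))"
proof (induction k arbitrary: f)
  case 0
  then show ?case by (auto intro: assms bounded_linear.continuous_on)
next
  case (Suc k)
  have d: "((\<lambda>x. T (f x)) has_derivative (\<lambda>a. T (frechet_derivative f (at x) a))) (at x)"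
    if "x \<in> S" for x
    using Suc.prems that
    by (auto intro!: bounded_linear.has_derivative[OF assms(1)] simp: frechet_derivative_works)
  then have "frechet_derivative (\<lambda>x. T (f x)) (at x) a = T (frechet_derivative f (at x) a)"
    if "x \<in> S" for x a
    using frechet_derivative_at[OF d[OF that]] by metis
  then have "Ck_on k S (\<lambda>x. frechet_derivative (\<lambda>x. T (f x)) (at x) a)" for a
    using Suc.IH[of "\<lambda>x. frechet_derivative f (at x) a"] Suc.prems
    by (subst Ck_on_cong[OF assms(2)]) auto
  then show ?case using d by (auto simp: differentiable_def)
qed

lemma Ck_on_add:
  assumes "open S"
  shows "Ck_on k S f \<Longrightarrow> Ck_on k S g \<Longrightarrow> Ck_on k S (\<lambda>x. f x + g x)"
proof (induction k arbitrary: f g)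
  case 0
  then show ?case by (auto intro: continuous_on_add)
next
  case (Suc k)
  let ?D = "\<lambda>x a. frechet_derivative f (at x) a + frechet_derivative g (at x) a"
  have d: "((\<lambda>x. f x + g x) has_derivative ?D x) (at x)" if "x \<in> S" for x
    using Suc.prems that by (auto intro!: has_derivative_add simp: frechet_derivative_works)
  then have "frechet_derivative (\<lambda>x. f x + g x) (at x) a = ?D x a" if "x \<in> S" for x a
    using frechet_derivative_at[OF d[OF that]] by metis
  then have "Ck_on k S (\<lambda>x. frechet_derivative (\<lambda>x. f x + g x) (at x) a)" for a
    using Suc.IH[of "\<lambda>x. frechet_derivative f (at x) a" "\<lambda>x. frechet_derivative g (at x) a"]
      Suc.prems
    by (subst Ck_on_cong[OF assms]) auto
  then show ?case using d by (auto simp: differentiable_def)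
qed

lemma Ck_on_mult:
  fixes f g :: "'e::euclidean_space \<Rightarrow> 'b::real_normed_algebra"
  assumes "open S"
  shows "Ck_on k S f \<Longrightarrow> Ck_on k S g \<Longrightarrow> Ck_on k S (\<lambda>x. f x * g x)"
proof (induction k arbitrary: f g)
  case 0
  then show ?case by (auto intro: continuous_on_mult)
next
  case (Suc k)
  let ?D = "\<lambda>x a. f x * frechet_derivative g (at x) a + frechet_derivative f (at x) a * g x"
  have d: "((\<lambda>x. f x * g x) has_derivative ?D x) (at x)" if "x \<in> S" for x
    using Suc.prems that by (auto intro!: has_derivative_mult simp: frechet_derivative_works)
  then have "frechet_derivative (\<lambda>x. f x * g x) (at x) a = ?D x a" if "x \<in> S" for x a
    using frechet_derivative_at[OF d[OF that]] by metis
  \<comment> \<open>Each term of the product rule keeps one factor undifferentiated;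
    \<open>Ck_on_SucD\<close> lowers it to class \<open>k\<close> for the induction
    hypothesis.\<close>
  moreover have "Ck_on k S (\<lambda>x. ?D x a)" for a
    using Suc.prems Ck_on_SucD[OF Suc.prems(1)] Ck_on_SucD[OF Suc.prems(2)]
    by (intro Ck_on_add[OF assms] Suc.IH) auto
  ultimately have "Ck_on k S (\<lambda>x. frechet_derivative (\<lambda>x. f x * g x) (at x) a)" for a
    by (subst Ck_on_cong[OF assms]) auto
  then show ?case using d by (auto simp: differentiable_def)
qed

section \<open>The algebra of smooth functions on the manifold\<close>

lemma smooth_atlas_open_image: "smooth_atlas A \<Longrightarrow> (U, \<kappa>) \<in> A \<Longrightarrow> open (\<kappa> ` U)"
  unfolding smooth_atlas_def by (auto simp: is_chart_def dest!: bspec)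

lemma smooth_fun_const: "smooth_fun A (\<lambda>p. c)"
  unfolding smooth_fun_def smooth_on_def by (auto intro: Ck_on_const)

text \<open>Serves for the real and imaginary parts of \<open>alpha\<close> and for the embedding of
  real coframe values into the complex numbers.\<close>

lemma smooth_fun_bounded_linear:
  assumes "smooth_atlas A" "bounded_linear T" "smooth_fun A f"
  shows "smooth_fun A (\<lambda>p. T (f p))"
  unfolding smooth_fun_def smooth_on_def
proof clarify
  fix U \<kappa> k assume c: "(U, \<kappa>) \<in> A"
  then have "Ck_on k (\<kappa> ` U) (\<lambda>x. f (inv_into U \<kappa> x))"
    using assms(3) unfolding smooth_fun_def smooth_on_def by blast
  then show "Ck_on k (\<kappa> ` U) (\<lambda>x. T (f (inv_into U \<kappa> x)))"
    by (rule Ck_on_bounded_linear[OF assms(2) smooth_atlas_open_image[OF assms(1) c]])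
qed

lemma smooth_fun_add:
  assumes "smooth_atlas A" "smooth_fun A f" "smooth_fun A g"
  shows "smooth_fun A (\<lambda>p. f p + g p)"
  unfolding smooth_fun_def smooth_on_def
proof clarify
  fix U \<kappa> k assume c: "(U, \<kappa>) \<in> A"
  then have "Ck_on k (\<kappa> ` U) (\<lambda>x. f (inv_into U \<kappa> x))"
    "Ck_on k (\<kappa> ` U) (\<lambda>x. g (inv_into U \<kappa> x))"
    using assms(2,3) unfolding smooth_fun_def smooth_on_def by blast+
  then show "Ck_on k (\<kappa> ` U) (\<lambda>x. f (inv_into U \<kappa> x) + g (inv_into U \<kappa> x))"
    by (rule Ck_on_add[OF smooth_atlas_open_image[OF assms(1) c]])
qed

lemma smooth_fun_mult:
  fixes f g :: "'a::{t2_space, second_countable_topology} \<Rightarrow> 'b::real_normed_algebra"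
  assumes "smooth_atlas A" "smooth_fun A f" "smooth_fun A g"
  shows "smooth_fun A (\<lambda>p. f p * g p)"
  unfolding smooth_fun_def smooth_on_def
proof clarify
  fix U \<kappa> k assume c: "(U, \<kappa>) \<in> A"
  then have "Ck_on k (\<kappa> ` U) (\<lambda>x. f (inv_into U \<kappa> x))"
    "Ck_on k (\<kappa> ` U) (\<lambda>x. g (inv_into U \<kappa> x))"
    using assms(2,3) unfolding smooth_fun_def smooth_on_def by blast+
  then show "Ck_on k (\<kappa> ` U) (\<lambda>x. f (inv_into U \<kappa> x) * g (inv_into U \<kappa> x))"
    by (rule Ck_on_mult[OF smooth_atlas_open_image[OF assms(1) c]])
qed

lemma smooth_fun_cmult:
  fixes f :: "'a::{t2_space, second_countable_topology} \<Rightarrow> real"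
  assumes "smooth_atlas A" "smooth_fun A f"
  shows "smooth_fun A (\<lambda>p. c * f p)"
  by (intro smooth_fun_mult smooth_fun_const assms)

lemma smooth_fun_sum:
  assumes "smooth_atlas A" "\<And>i. i \<in> I \<Longrightarrow> smooth_fun A (f i)"
  shows "smooth_fun A (\<lambda>p. \<Sum>i\<in>I. f i p)"
  using assms(2)
proof (induction I rule: infinite_finite_induct)
  case (insert i I)
  then show ?case by (simp add: smooth_fun_add[OF assms(1)])
qed (simp_all add: smooth_fun_const)

lemma smooth_alpha:
  assumes "smooth_atlas A" "\<forall>i\<in>{1..n}. \<forall>j\<in>{1..n}. \<forall>k\<in>{1..n}. smooth_fun A (l i j k)" "k \<in> {1..n}"
  shows "smooth_fun A (alpha n l k)"
proof -
  have "smooth_fun A (\<lambda>p. \<Sum>i=1..n. l i i k p)"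
    using assms by (intro smooth_fun_sum) auto
  then show ?thesis by (simp add: alpha_def[abs_def])
qed

section \<open>Tangent vectors and brackets\<close>

lemma
  assumes "D \<in> tangent_space A p"
  shows tangent_add: "smooth_fun A f \<Longrightarrow> smooth_fun A g \<Longrightarrow> D (\<lambda>q. f q + g q) = D f + D g"
    and tangent_cmult: "smooth_fun A f \<Longrightarrow> D (\<lambda>q. c * f q) = c * D f"
    and tangent_mult:
      "smooth_fun A f \<Longrightarrow> smooth_fun A g \<Longrightarrow> D (\<lambda>q. f q * g q) = f p * D g + g p * D f"
    and tangent_nonsmooth: "\<not> smooth_fun A f \<Longrightarrow> D f = 0"
  using assms unfolding tangent_space_def by blast+

lemma tangent_const:
  assumes "D \<in> tangent_space A p"
  shows "D (\<lambda>q. c) = 0"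
proof -
  have "D (\<lambda>q. 1) = 0"
    using tangent_mult[OF assms smooth_fun_const smooth_fun_const, of 1 1] by simp
  then show ?thesis
    using tangent_cmult[OF assms smooth_fun_const, of c 1] by simp
qed

lemma tangent_diff:
  assumes "D \<in> tangent_space A p" "smooth_atlas A" "smooth_fun A f" "smooth_fun A g"
  shows "D (\<lambda>q. f q - g q) = D f - D g"
  using tangent_add[OF assms(1,3) smooth_fun_cmult[OF assms(2,4), of "-1"]]
    tangent_cmult[OF assms(1,4), of "-1"] by simp

text \<open>Brackets are compared as HOL functions, hence also on non-smooth arguments. If
  \<open>f\<close> is not smooth and \<open>c\<close> is nonzero, then \<open>c * f\<close> is not
  smooth either, since multiplying by \<open>inverse c\<close> recovers \<open>f\<close>; both sides
  then take the default value 0.\<close>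

lemma tangent_cmult_all:
  assumes "D \<in> tangent_space A p" "smooth_atlas A"
  shows "D (\<lambda>q. c * f q) = c * D f"
proof (cases "smooth_fun A f \<or> c = 0")
  case True
  then show ?thesis using tangent_cmult[OF assms(1)] tangent_const[OF assms(1)] by auto
next
  case False
  then have "\<not> smooth_fun A (\<lambda>q. c * f q)"
    using smooth_fun_cmult[OF assms(2), of "\<lambda>q. c * f q" "inverse c"]
    by (auto simp: mult.assoc[symmetric])
  then show ?thesis using False tangent_nonsmooth[OF assms(1)] by auto
qed

lemma zero_in_tangent_space: "(\<lambda>f. 0) \<in> tangent_space A p"
  unfolding tangent_space_def by simp

lemma add_in_tangent_space:
  "a \<in> tangent_space A p \<Longrightarrow> b \<in> tangent_space A p \<Longrightarrow> (\<lambda>f. a f + b f) \<in> tangent_space A p"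
  unfolding tangent_space_def by (simp add: algebra_simps)

lemma cmult_in_tangent_space:
  "a \<in> tangent_space A p \<Longrightarrow> (\<lambda>f. c * a f) \<in> tangent_space A p"
  unfolding tangent_space_def by (simp add: algebra_simps)

lemma sum_in_tangent_space:
  assumes "\<And>i. i \<in> I \<Longrightarrow> a i \<in> tangent_space A p"
  shows "(\<lambda>f. \<Sum>i\<in>I. a i f) \<in> tangent_space A p"
  using assms
proof (induction I rule: infinite_finite_induct)
  case (insert i I)
  then show ?case by (simp add: add_in_tangent_space)
qed (simp_all add: zero_in_tangent_space)

section \<open>Vector fields and Lie brackets\<close>

lemma
  assumes "smooth_vfield A X"
  shows smooth_vfield_tangent: "X p \<in> tangent_space A p"
    and smooth_vfield_deriv: "smooth_fun A f \<Longrightarrow> smooth_fun A (deriv_along X f)"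
  using assms unfolding smooth_vfield_def by auto

text \<open>For a product of \<open>f\<close> and \<open>g\<close>, the mixed terms
  \<open>X f * Y g\<close> and \<open>Y f * X g\<close> occur in both iterated derivatives and
  cancel in the difference, which leaves the Leibniz rule.\<close>

lemma lie_bracket_in_tangent_space:
  assumes A: "smooth_atlas A" and X: "smooth_vfield A X" and Y: "smooth_vfield A Y"
  shows "lie_bracket X Y p \<in> tangent_space A p"
proof -
  have D: "deriv_along Z (\<lambda>q. f q + g q) = (\<lambda>q. deriv_along Z f q + deriv_along Z g q)"
    "deriv_along Z (\<lambda>q. f q * g q) = (\<lambda>q. f q * deriv_along Z g q + g q * deriv_along Z f q)"
    if "smooth_vfield A Z" "smooth_fun A f" "smooth_fun A g" for Z f g
    using tangent_add[OF smooth_vfield_tangent[OF that(1)] that(2,3)]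
      tangent_mult[OF smooth_vfield_tangent[OF that(1)] that(2,3)]
    by (simp_all add: deriv_along_def)
  have C: "deriv_along Z (\<lambda>q. c * f q) = (\<lambda>q. c * deriv_along Z f q)"
    if "smooth_vfield A Z" for Z f c
    using tangent_cmult_all[OF smooth_vfield_tangent[OF that] A] by (simp add: deriv_along_def)
  \<comment> \<open>\<open>N\<close> and \<open>Z\<close> settle the default clause: on a non-smooth
    function the inner derivative is the zero function, which the outer one sends to 0.\<close>
  have N: "deriv_along Z f = (\<lambda>q. 0)" if "smooth_vfield A Z" "\<not> smooth_fun A f" for Z f
    using tangent_nonsmooth[OF smooth_vfield_tangent[OF that(1)] that(2)] by (simp add: deriv_along_def)
  have Z: "deriv_along Z (\<lambda>q. 0) = (\<lambda>q. 0)" if "smooth_vfield A Z" for Z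
    using tangent_const[OF smooth_vfield_tangent[OF that]] by (simp add: deriv_along_def)
  show ?thesis
    unfolding tangent_space_def lie_bracket_def
    by (auto simp: X Y D C N Z smooth_vfield_deriv[OF X] smooth_vfield_deriv[OF Y]
        smooth_fun_add[OF A] smooth_fun_mult[OF A] algebra_simps)
qed

lemma lie_bracket_cmult:
  assumes A: "smooth_atlas A" and X: "smooth_vfield A X" and Y: "smooth_vfield A Y"
  shows "lie_bracket (\<lambda>p f. a * X p f) (\<lambda>p f. b * Y p f) p = (\<lambda>f. (a * b) * lie_bracket X Y p f)"
  using tangent_cmult_all[OF smooth_vfield_tangent[OF X] A]
    tangent_cmult_all[OF smooth_vfield_tangent[OF Y] A]
  by (simp add: lie_bracket_def deriv_along_def algebra_simps)

text \<open>The sign is written as a factor \<open>-1\<close> so that \<open>form1_cmult\<close>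
  applies to it.\<close>

lemma lie_bracket_swap: "lie_bracket Y X p = (\<lambda>f. -1 * lie_bracket X Y p f)"
  by (simp add: lie_bracket_def)

lemma lie_bracket_self: "lie_bracket X X p = (\<lambda>f. 0)"
  by (simp add: lie_bracket_def)

section \<open>One-forms and the frame expansion\<close>

lemma
  assumes "smooth_form1 A \<theta>"
  shows form1_add: "a \<in> tangent_space A p \<Longrightarrow> b \<in> tangent_space A p \<Longrightarrow>
      \<theta> p (\<lambda>f. a f + b f) = \<theta> p a + \<theta> p b"
    and form1_cmult: "a \<in> tangent_space A p \<Longrightarrow> \<theta> p (\<lambda>f. c * a f) = c *\<^sub>R \<theta> p a"
  using assms unfolding smooth_form1_def by blast+

lemma form1_zero: "smooth_form1 A \<theta> \<Longrightarrow> \<theta> p (\<lambda>f. 0) = 0"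
  using form1_cmult[OF _ zero_in_tangent_space, of A \<theta> p 0] by simp

lemma form1_sum:
  assumes "smooth_form1 A \<theta>" "\<And>i. i \<in> I \<Longrightarrow> a i \<in> tangent_space A p"
  shows "\<theta> p (\<lambda>f. \<Sum>i\<in>I. a i f) = (\<Sum>i\<in>I. \<theta> p (a i))"
  using assms(2)
proof (induction I rule: infinite_finite_induct)
  case (insert i I)
  then show ?case
    by (simp add: form1_add[OF assms(1)] sum_in_tangent_space)
qed (simp_all add: form1_zero[OF assms(1)])

lemma form1_frame_sum:
  assumes \<theta>: "smooth_form1 A \<theta>" and X: "\<And>i. i \<in> I \<Longrightarrow> a i \<in> tangent_space A p"
    and Y: "\<And>i. i \<in> I \<Longrightarrow> b i \<in> tangent_space A p"
  shows "\<theta> p (\<lambda>f. \<Sum>i\<in>I. c i * a i f + d i * b i f) =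
    (\<Sum>i\<in>I. c i *\<^sub>R \<theta> p (a i) + d i *\<^sub>R \<theta> p (b i))"
proof -
  have "\<theta> p (\<lambda>f. \<Sum>i\<in>I. c i * a i f + d i * b i f) = (\<Sum>i\<in>I. \<theta> p (\<lambda>f. c i * a i f + d i * b i f))"
    by (intro form1_sum[OF \<theta>] add_in_tangent_space cmult_in_tangent_space X Y)
  also have "\<dots> = (\<Sum>i\<in>I. c i *\<^sub>R \<theta> p (a i) + d i *\<^sub>R \<theta> p (b i))"
    by (intro sum.cong refl)
      (simp add: form1_add[OF \<theta>] form1_cmult[OF \<theta>] cmult_in_tangent_space X Y)
  finally show ?thesis .
qed

text \<open>Spanning yields some coefficients; applying the coframe to that expansion identifies
  them by duality. This recovers a bracket from its coframe values.\<close>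

lemma tangent_frame_expansion:
  assumes frame: "global_frame A n V W" and coframe: "dual_coframe A n V W V' W'"
    and a: "a \<in> tangent_space A p"
  shows "a f = (\<Sum>i=1..n. V' i p a * V i p f + W' i p a * W i p f)"
proof -
  obtain c d where a_eq: "a = (\<lambda>f. \<Sum>i=1..n. c i * V i p f + d i * W i p f)"
    using frame a unfolding global_frame_def by blast
  have VT: "V i p \<in> tangent_space A p" "W i p \<in> tangent_space A p" if "i \<in> {1..n}" for i
    using frame that unfolding global_frame_def by (auto intro: smooth_vfield_tangent)
  have "V' i p a = c i \<and> W' i p a = d i" if i: "i \<in> {1..n}" for i
  proof -
    have S: "smooth_form1 A (V' i)" "smooth_form1 A (W' i)"
      using coframe i unfolding dual_coframe_def by auto
    have dual: "V' i p (V j p) = (if i = j then 1 else 0)" "V' i p (W j p) = 0"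
      "W' i p (V j p) = 0" "W' i p (W j p) = (if i = j then 1 else 0)" if "j \<in> {1..n}" for j
      using coframe i that unfolding dual_coframe_def by auto
    have "V' i p a = (\<Sum>j=1..n. if i = j then c j else 0)"
      unfolding a_eq
      by (rule trans[OF form1_frame_sum[OF S(1)] sum.cong]) (auto simp: VT dual)
    moreover have "W' i p a = (\<Sum>j=1..n. if i = j then d j else 0)"
      unfolding a_eq
      by (rule trans[OF form1_frame_sum[OF S(2)] sum.cong]) (auto simp: VT dual)
    ultimately show ?thesis using i by simp
  qed
  then show ?thesis by (subst a_eq) simp
qed

lemma smooth_form1_coframe10:
  assumes A: "smooth_atlas A" and "smooth_form1 A (V' i)" "smooth_form1 A (W' i)"
  shows "smooth_form1 A (coframe10 V' W' i)"
  using assms(2,3) unfolding smooth_form1_def coframe10_def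
  by (auto simp: scaleR_conv_of_real algebra_simps
      intro!: smooth_fun_add[OF A] smooth_fun_mult[OF A] smooth_fun_const
        smooth_fun_bounded_linear[OF A bounded_linear_of_real])

section \<open>The bracket of the frame fields\<close>

text \<open>Constant pairings kill both derivative terms of the invariant formula, so only the
  bracket term survives. The constants \<open>a\<close> and \<open>b\<close> absorb the factors in
  \<open>part10\<close> and \<open>part01\<close>.\<close>

lemma ext_deriv_cmult_const:
  assumes A: "smooth_atlas A" and \<theta>: "smooth_form1 A \<theta>"
    and X: "smooth_vfield A X" and Y: "smooth_vfield A Y"
    and "\<And>q. \<theta> q (X q) = x" "\<And>q. \<theta> q (Y q) = y"
  shows "ext_deriv \<theta> (\<lambda>p f. a * X p f) (\<lambda>p f. b * Y p f) p = - (a * b) *\<^sub>R \<theta> p (lie_bracket X Y p)"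
  using assms(5,6) tangent_const[OF smooth_vfield_tangent[OF X]]
    tangent_const[OF smooth_vfield_tangent[OF Y]]
  by (simp add: ext_deriv_def cderiv_along_def deriv_along_def lie_bracket_cmult[OF A X Y]
      form1_cmult[OF \<theta> lie_bracket_in_tangent_space[OF A X Y]]
      form1_cmult[OF \<theta> smooth_vfield_tangent[OF X]] form1_cmult[OF \<theta> smooth_vfield_tangent[OF Y]]
      flip: zero_complex.code)

text \<open>Since \<open>Y = J X\<close>, the (1,0)-parts of \<open>X\<close> and \<open>Y\<close>
  are proportional, and so are their (0,1)-parts. The (2,0) and (0,2) components of a 2-form
  therefore vanish on this pair, and \<open>dbar10\<close> agrees there with the full exterior
  derivative.\<close>

lemma dbar10_frame_pair:
  assumes A: "smooth_atlas A" and \<theta>: "smooth_form1 A \<theta>"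
    and X: "smooth_vfield A X" and Y: "smooth_vfield A Y"
    and JX: "\<And>p. J p (X p) = Y p" and JY: "\<And>p. J p (Y p) = (\<lambda>f. - X p f)"
    and x: "\<And>q. \<theta> q (X q) = x" and y: "\<And>q. \<theta> q (Y q) = y"
  shows "dbar10 J \<theta> X Y p = - \<theta> p (lie_bracket X Y p)"
proof -
  \<comment> \<open>Brings the (1,0)- and (0,1)-parts into the shape of constant multiples of
    \<open>X\<close> and \<open>Y\<close> that \<open>E\<close> matches.\<close>
  have half: "(\<lambda>p f. Z p f / 2) = (\<lambda>p f. (1/2) * Z p f)"
    "(\<lambda>p f. (1/2) * - Z p f) = (\<lambda>p f. (-1/2) * Z p f)" for Z :: "'a vfield"
    by simp_all
  have E: "ext_deriv \<theta> (\<lambda>p f. a * X p f) (\<lambda>p f. b * Y p f) p = - (a * b) *\<^sub>R \<theta> p (lie_bracket X Y p)"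
    "ext_deriv \<theta> (\<lambda>p f. a * Y p f) (\<lambda>p f. b * X p f) p = (a * b) *\<^sub>R \<theta> p (lie_bracket X Y p)"
    "ext_deriv \<theta> (\<lambda>p f. a * X p f) (\<lambda>p f. b * X p f) p = 0"
    "ext_deriv \<theta> (\<lambda>p f. a * Y p f) (\<lambda>p f. b * Y p f) p = 0" for a b
    unfolding ext_deriv_cmult_const[of A \<theta> X Y x y, OF A \<theta> X Y x y] ext_deriv_cmult_const[of A \<theta> Y X y x, OF A \<theta> Y X y x]
      ext_deriv_cmult_const[of A \<theta> X X x x, OF A \<theta> X X x x] ext_deriv_cmult_const[of A \<theta> Y Y y y, OF A \<theta> Y Y y y]
      lie_bracket_self form1_zero[OF \<theta>] lie_bracket_swap[of Y X]
      form1_cmult[OF \<theta> lie_bracket_in_tangent_space[OF A X Y]]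
    by simp_all
  show ?thesis
    unfolding dbar10_def component11_def part10_def part01_def cform2_eval_def fst_conv snd_conv
      JX JY minus_minus half E
    by (simp add: scaleR_conv_of_real)
qed

text \<open>The forms \<open>\<phi>\<^sup>i\<close> are constant on \<open>V k\<close> and
  \<open>W k\<close>, so \<open>dbar10_frame_pair\<close> turns the structure equation on this pair
  into the coframe values of the bracket.\<close>

lemma frame_bracket:
  assumes A: "smooth_atlas A"
    and frame: "global_frame A n V W"
    and J_frame: "\<forall>i\<in>{1..n}. \<forall>p. J p (V i p) = W i p \<and> J p (W i p) = (\<lambda>f. - V i p f)"
    and coframe: "dual_coframe A n V W V' W'"
    and l_def: "\<forall>i\<in>{1..n}. \<forall>X Y. smooth_vfield A X \<longrightarrow> smooth_vfield A Y \<longrightarrow> (\<forall>p.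
        dbar10 J (coframe10 V' W' i) X Y p =
          (\<Sum>j=1..n. \<Sum>k=1..n. l i j k p *
             wedge (coframe10 V' W' j) (cnj_form1 (coframe10 V' W' k)) X Y p))"
    and k: "k \<in> {1..n}"
  shows "lie_bracket (V k) (W k) p f =
    (\<Sum>i=1..n. 2 * Re (l i k k p) * W i p f - 2 * Im (l i k k p) * V i p f)"
proof -
  let ?B = "lie_bracket (V k) (W k) p"
  let ?\<phi> = "coframe10 V' W'"
  have S: "smooth_vfield A (V k)" "smooth_vfield A (W k)"
    using frame k unfolding global_frame_def by auto
  have \<phi>: "?\<phi> j q (V k q) = (if j = k then 1 else 0)" "?\<phi> j q (W k q) = (if j = k then \<i> else 0)"
    if "j \<in> {1..n}" for j q
    using coframe that k unfolding dual_coframe_def coframe10_def by auto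
  have "V' i p ?B = - 2 * Im (l i k k p) \<and> W' i p ?B = 2 * Re (l i k k p)" if i: "i \<in> {1..n}" for i
  proof -
    have sm: "smooth_form1 A (?\<phi> i)"
      using coframe i unfolding dual_coframe_def by (auto intro: smooth_form1_coframe10[OF A])
    have "- ?\<phi> i p ?B = dbar10 J (?\<phi> i) (V k) (W k) p"
      using J_frame k \<phi>[OF i] by (subst dbar10_frame_pair[OF A sm S]) auto
    also have "\<dots> = (\<Sum>j=1..n. \<Sum>h=1..n. l i j h p * wedge (?\<phi> j) (cnj_form1 (?\<phi> h)) (V k) (W k) p)"
      using l_def i S by blast
    \<comment> \<open>Only \<open>j = h = k\<close> pairs nontrivially with \<open>V k\<close> and
      \<open>W k\<close>; there the wedge is \<open>1 * (-\<i>) - \<i> * 1\<close>.\<close>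
    also have "\<dots> = (\<Sum>j=1..n. \<Sum>h=1..n. if h = k then (if j = k then - 2 * \<i> * l i j h p else 0) else 0)"
      by (intro sum.cong refl) (simp add: wedge_def cnj_form1_def \<phi>)
    also have "\<dots> = - 2 * \<i> * l i k k p"
      using k by simp
    finally have "?\<phi> i p ?B = 2 * \<i> * l i k k p" by simp
    then show ?thesis by (simp add: coframe10_def complex_eq_iff)
  qed
  then show ?thesis
    unfolding tangent_frame_expansion[OF frame coframe lie_bracket_in_tangent_space[OF A S], where f = f]
    by (intro sum.cong) auto
qed

section \<open>The second order equations\<close>

text \<open>The real part of \<open>L\<^sub>m F = 4m(R\<^sub>m + \<i> Im \<beta>) F\<close> holds summand by summand in \<open>k\<close>.\<close>

lemma L_op_real_part:
  assumes A: "smooth_atlas A"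
    and frame: "global_frame A n V W"
    and bracket: "\<And>k f. k \<in> {1..n} \<Longrightarrow> lie_bracket (V k) (W k) p f =
      (\<Sum>i=1..n. 2 * Re (l i k k p) * W i p f - 2 * Im (l i k k p) * V i p f)"
    and l_smooth: "\<forall>i\<in>{1..n}. \<forall>j\<in>{1..n}. \<forall>k\<in>{1..n}. smooth_fun A (l i j k)"
    and u: "smooth_fun A u"
    and v: "smooth_fun A v"
    and eq1: "\<And>k p. k \<in> {1..n} \<Longrightarrow> deriv_along (V k) u p - deriv_along (W k) v p =
        2 * real m * (Re (alpha n l k p) * u p - Im (alpha n l k p) * v p)"
    and eq2: "\<And>k p. k \<in> {1..n} \<Longrightarrow> deriv_along (V k) v p + deriv_along (W k) u p =
        2 * real m * (Re (alpha n l k p) * v p + Im (alpha n l k p) * u p)"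
  shows "L_op n V W l m u p = 4 * real m * (R_fun n V W l m p * u p - Im (beta n V W l p) * v p)"
proof -
  let ?a = "\<lambda>k p. Re (alpha n l k p)" and ?b = "\<lambda>k p. Im (alpha n l k p)"
  let ?P = "\<lambda>k. \<Sum>i=1..n. l i k k p * cnj (alpha n l i p)"
  let ?Z = "\<lambda>k. cvf_apply (frame10 V W k) (alpha n l k) p"
  have summand:
    "deriv_along (V k) (deriv_along (V k) u) p + deriv_along (W k) (deriv_along (W k) u) p
     - 4 * real m * ?a k p * deriv_along (V k) u p
     - 4 * real m * ?b k p * deriv_along (W k) u p
     - 2 * (\<Sum>i=1..n. Re (l i k k p) * deriv_along (V i) u p)
     - 2 * (\<Sum>i=1..n. Im (l i k k p) * deriv_along (W i) u p)
     = 4 * real m * (Re (?Z k - of_nat m * of_real ((cmod (alpha n l k p))\<^sup>2) - ?P k) * u p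
         - Im (?Z k + ?P k) * v p)" (is "?lhs = ?rhs") if k: "k \<in> {1..n}" for k
  proof -
    have S: "smooth_vfield A (V k)" "smooth_vfield A (W k)"
      using frame k unfolding global_frame_def by auto
    note T = smooth_vfield_tangent[OF S(1), of p] smooth_vfield_tangent[OF S(2), of p]
    note sa = smooth_alpha[OF A l_smooth k]
    have sab: "smooth_fun A (?a k)" "smooth_fun A (?b k)"
      by (intro smooth_fun_bounded_linear[OF A _ sa] bounded_linear_Re bounded_linear_Im)+
    note sm = smooth_fun_mult[OF A sab(1) u] smooth_fun_mult[OF A sab(1) v]
      smooth_fun_mult[OF A sab(2) u] smooth_fun_mult[OF A sab(2) v]
    have smd: "smooth_fun A (\<lambda>q. ?a k q * u q - ?b k q * v q)"
      using smooth_fun_add[OF A sm(1) smooth_fun_cmult[OF A sm(4), of "-1"]] by simp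
    note sms = smooth_fun_add[OF A sm(2) sm(3)]
    note sd = smooth_vfield_deriv[OF S(1) v] smooth_vfield_deriv[OF S(2) v]
    \<comment> \<open>The first order equations hold at every point, so they are equalities of
      functions and can be differentiated again: this one along \<open>V k\<close>, the one for
      \<open>W k\<close> along \<open>W k\<close>. Both are solved for derivatives of
      \<open>u\<close>, so that the remaining second derivatives fall on \<open>v\<close> in crossed
      order.\<close>
    have Vu: "deriv_along (V k) u =
        (\<lambda>q. deriv_along (W k) v q + 2 * real m * (?a k q * u q - ?b k q * v q))"
      using eq1[OF k] by (simp add: fun_eq_iff algebra_simps)
    have VVu: "V k p (deriv_along (V k) u) = V k p (deriv_along (W k) v)
        + 2 * real m * (?a k p * V k p u + u p * V k p (?a k) - ?b k p * V k p v - v p * V k p (?b k))"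
      unfolding Vu tangent_add[OF T(1) sd(2) smooth_fun_cmult[OF A smd]]
        tangent_cmult[OF T(1) smd] tangent_diff[OF T(1) A sm(1,4)]
        tangent_mult[OF T(1) sab(1) u] tangent_mult[OF T(1) sab(2) v] by (simp add: algebra_simps)
    have Wu: "deriv_along (W k) u =
        (\<lambda>q. 2 * real m * (?a k q * v q + ?b k q * u q) - deriv_along (V k) v q)"
      using eq2[OF k] by (simp add: fun_eq_iff algebra_simps)
    have WWu: "W k p (deriv_along (W k) u) = - W k p (deriv_along (V k) v)
        + 2 * real m * (?a k p * W k p v + v p * W k p (?a k) + ?b k p * W k p u + u p * W k p (?b k))"
      unfolding Wu tangent_diff[OF T(2) A smooth_fun_cmult[OF A sms] sd(1)]
        tangent_cmult[OF T(2) sms] tangent_add[OF T(2) sm(2,3)]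
        tangent_mult[OF T(2) sab(1) v] tangent_mult[OF T(2) sab(2) u] by (simp add: algebra_simps)
    have e1: "V k p u - W k p v = 2 * real m * (?a k p * u p - ?b k p * v p)"
      and e2: "V k p v + W k p u = 2 * real m * (?a k p * v p + ?b k p * u p)"
      using eq1[OF k, of p] eq2[OF k, of p] by (simp_all add: deriv_along_def)
    \<comment> \<open>Adding \<open>VVu\<close> and \<open>WWu\<close> leaves exactly this
      commutator as second order part; the bracket formula makes it first order.\<close>
    have br: "V k p (deriv_along (W k) v) - W k p (deriv_along (V k) v) =
        (\<Sum>i=1..n. 2 * Re (l i k k p) * W i p v - 2 * Im (l i k k p) * V i p v)"
      using bracket[OF k, of v] by (simp add: lie_bracket_def deriv_along_def)
    \<comment> \<open>The bracket terms meet the \<open>l i k k\<close> terms of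
      \<open>L_op\<close>. For each \<open>i\<close> they combine to the left sides of the two
      equations with index \<open>i\<close>, so every derivative cancels.\<close>
    have lower: "(\<Sum>i=1..n. 2 * Re (l i k k p) * W i p v - 2 * Im (l i k k p) * V i p v)
        - 2 * (\<Sum>i=1..n. Re (l i k k p) * V i p u) - 2 * (\<Sum>i=1..n. Im (l i k k p) * W i p u)
        = - 4 * real m * (Re (?P k) * u p + Im (?P k) * v p)"
    proof -
      have "2 * Re (l i k k p) * W i p v - 2 * Im (l i k k p) * V i p v
          - 2 * (Re (l i k k p) * V i p u) - 2 * (Im (l i k k p) * W i p u)
          = - 4 * real m * (Re (l i k k p * cnj (alpha n l i p)) * u p
              + Im (l i k k p * cnj (alpha n l i p)) * v p)" if i: "i \<in> {1..n}" for i
      proof -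
        have *: "V i p u = W i p v + 2 * real m * (?a i p * u p - ?b i p * v p)"
          "V i p v = 2 * real m * (?a i p * v p + ?b i p * u p) - W i p u"
          using eq1[OF i, of p] eq2[OF i, of p] by (simp_all add: deriv_along_def)
        show ?thesis unfolding * by (simp add: algebra_simps)
      qed
      then have "(\<Sum>i=1..n. 2 * Re (l i k k p) * W i p v - 2 * Im (l i k k p) * V i p v
          - 2 * (Re (l i k k p) * V i p u) - 2 * (Im (l i k k p) * W i p u))
          = (\<Sum>i=1..n. - 4 * real m * (Re (l i k k p * cnj (alpha n l i p)) * u p
              + Im (l i k k p * cnj (alpha n l i p)) * v p))"
        by (intro sum.cong) auto
      then show ?thesis
        unfolding Re_sum Im_sum sum_distrib_right sum_subtractf
        by (simp only: sum.distrib sum_distrib_left[symmetric] sum_distrib_right[symmetric])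
    qed
    \<comment> \<open>The sums \<open>VVu\<close> and \<open>WWu\<close> contain precisely these
      combinations of derivatives of \<open>alpha\<close>; the halves turn their factor
      \<open>2 * m\<close> into \<open>4 * m\<close>.\<close>
    have Z: "Re (?Z k) = (V k p (?a k) + W k p (?b k)) / 2" "Im (?Z k) = (V k p (?b k) - W k p (?a k)) / 2"
      by (simp_all add: cvf_apply_def cderiv_along_def deriv_along_def frame10_def field_simps)
    have norm: "(cmod (alpha n l k p))\<^sup>2 = (?a k p)\<^sup>2 + (?b k p)\<^sup>2"
      by (simp add: cmod_power2)
    \<comment> \<open>The drift terms of \<open>L_op\<close> have the coefficients that complete the
      derivatives of \<open>u\<close> and \<open>v\<close> to the left sides of \<open>e1\<close>
      and \<open>e2\<close>; this produces the square of \<open>cmod\<close> in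
      \<open>R_fun\<close>.\<close>
    have first: "2 * real m * (?a k p * V k p u - ?b k p * V k p v + ?a k p * W k p v + ?b k p * W k p u)
        - 4 * real m * ?a k p * V k p u - 4 * real m * ?b k p * W k p u
        = - 4 * real m * real m * ((?a k p)\<^sup>2 + (?b k p)\<^sup>2) * u p"
    proof -
      have "2 * real m * (?a k p * V k p u - ?b k p * V k p v + ?a k p * W k p v + ?b k p * W k p u)
        - 4 * real m * ?a k p * V k p u - 4 * real m * ?b k p * W k p u
        = - 2 * real m * (?a k p * (V k p u - W k p v) + ?b k p * (V k p v + W k p u))"
        by (simp add: algebra_simps)
      also have "\<dots> = - 4 * real m * real m * ((?a k p)\<^sup>2 + (?b k p)\<^sup>2) * u p"
        unfolding e1 e2 by (simp add: algebra_simps power2_eq_square)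
      finally show ?thesis .
    qed
    \<comment> \<open>The last term contributes \<open>- Re (?P k)\<close> to the factor of
      \<open>u\<close> and, because \<open>Im\<close> enters \<open>?rhs\<close> with a minus,
      \<open>+ Im (?P k)\<close> to that of \<open>v\<close>. Hence the opposite signs of this sum
      in \<open>R_fun\<close> and \<open>beta\<close>.\<close>
    have "?lhs = 2 * real m * (u p * (V k p (?a k) + W k p (?b k)) - v p * (V k p (?b k) - W k p (?a k)))
        - 4 * real m * real m * ((?a k p)\<^sup>2 + (?b k p)\<^sup>2) * u p
        - 4 * real m * (Re (?P k) * u p + Im (?P k) * v p)"
      using VVu WWu br lower first unfolding deriv_along_def by (simp add: algebra_simps)
    also have "\<dots> = ?rhs"
      unfolding minus_complex.sel plus_complex.sel Z norm by (simp add: field_simps)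
    finally show ?thesis .
  qed
  have "L_op n V W l m u p = (\<Sum>k=1..n. 4 * real m *
      (Re (?Z k - of_nat m * of_real ((cmod (alpha n l k p))\<^sup>2) - ?P k) * u p - Im (?Z k + ?P k) * v p))"
    unfolding L_op_def by (rule sum.cong[OF refl summand])
  then show ?thesis
    unfolding R_fun_def beta_def Re_sum[of _ "{1..n}"] Im_sum[of _ "{1..n}"]
    by (simp only: sum_distrib_left[symmetric] sum_subtractf sum_distrib_right[symmetric])
qed

theorem mainTheorem3:
  fixes A :: "('a::{t2_space, second_countable_topology}, 'e::euclidean_space) chart set"
    and J :: "'a \<Rightarrow> 'a tvec \<Rightarrow> 'a tvec"
    and n m :: nat
    and V W :: "nat \<Rightarrow> 'a vfield"
    and V' W' :: "nat \<Rightarrow> ('a, real) form1"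
    and l :: "nat \<Rightarrow> nat \<Rightarrow> nat \<Rightarrow> 'a \<Rightarrow> complex"
    and u v :: "'a \<Rightarrow> real"
  assumes manifold: "smooth_atlas A"
    and dim: "DIM('e) = 2 * n"
    and J: "almost_complex A J"
    and frame: "global_frame A n V W"
    and J_frame: "\<forall>i\<in>{1..n}. \<forall>p. J p (V i p) = W i p \<and> J p (W i p) = (\<lambda>f. - V i p f)"
    and coframe: "dual_coframe A n V W V' W'"
    and l_smooth: "\<forall>i\<in>{1..n}. \<forall>j\<in>{1..n}. \<forall>k\<in>{1..n}. smooth_fun A (l i j k)"
    and l_def: "\<forall>i\<in>{1..n}. \<forall>X Y. smooth_vfield A X \<longrightarrow> smooth_vfield A Y \<longrightarrow> (\<forall>p.
        dbar10 J (coframe10 V' W' i) X Y p =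
          (\<Sum>j=1..n. \<Sum>k=1..n. l i j k p *
             wedge (coframe10 V' W' j) (cnj_form1 (coframe10 V' W' k)) X Y p))"
    and m: "m \<ge> 1"
    and u: "smooth_fun A u"
    and v: "smooth_fun A v"
    and eq1: "\<forall>k\<in>{1..n}. \<forall>p. deriv_along (V k) u p - deriv_along (W k) v p =
        2 * real m * (Re (alpha n l k p) * u p - Im (alpha n l k p) * v p)"
    and eq2: "\<forall>k\<in>{1..n}. \<forall>p. deriv_along (V k) v p + deriv_along (W k) u p =
        2 * real m * (Re (alpha n l k p) * v p + Im (alpha n l k p) * u p)"
  shows "(\<forall>p. L_op n V W l m v p - 4 * real m * R_fun n V W l m p * v p
               - 4 * real m * Im (beta n V W l p) * u p = 0) \<and>
         (\<forall>p. - L_op n V W l m u p + 4 * real m * R_fun n V W l m p * u p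
               - 4 * real m * Im (beta n V W l p) * v p = 0)"
proof -
  note br = frame_bracket[OF manifold frame J_frame coframe l_def]
  have Lu: "L_op n V W l m u p = 4 * real m * (R_fun n V W l m p * u p - Im (beta n V W l p) * v p)" for p
    using eq1 eq2 by (intro L_op_real_part[OF manifold frame br l_smooth u v]) auto
  \<comment> \<open>The first order system is complex linear in \<open>F\<close>, so
    \<open>-\<i>F = v - \<i>u\<close> solves it too: for the pair \<open>(v, -u)\<close> the first
    equation is \<open>eq2\<close> and the second is the negative of \<open>eq1\<close>.\<close>
  have minus_u: "smooth_fun A (\<lambda>q. - u q)"
    using smooth_fun_cmult[OF manifold u, of "-1"] by simp
  have D: "deriv_along X (\<lambda>q. - u q) p = - deriv_along X u p" if "smooth_vfield A X" for X p
    using tangent_cmult[OF smooth_vfield_tangent[OF that, of p] u, of "-1"]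
    by (simp add: deriv_along_def)
  have S: "smooth_vfield A (V k)" "smooth_vfield A (W k)" if "k \<in> {1..n}" for k
    using frame that unfolding global_frame_def by auto
  have Lv: "L_op n V W l m v p =
      4 * real m * (R_fun n V W l m p * v p - Im (beta n V W l p) * (- u p))" for p
    using eq1 eq2
    by (intro L_op_real_part[OF manifold frame br l_smooth v minus_u]) (auto simp: D S algebra_simps)
  show ?thesis
    by (auto simp: Lu Lv algebra_simps)
qed

end
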